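(* Let $k\ge1$ and $n\ge1$, and let $\tau_n$ be a uniformly random $(k+1)$-ary increasing tree of order $n$. Then the distribution of the random vector $(L_{n,1},\dots,L_{n,k+1})$ of $\tau_n$ is exchangeable, i.e. invariant under any permutation of its $k+1$ coordinates.
   Context: A $(k+1)$-ary increasing tree of order $n$ is a rooted tree with vertex set $\{1,\dots,n\}$, root $1$, labels increasing along every path away from the root, in which every vertex has $k+1$ positions numbered $1,\dots,k+1$ from left to right, each position empty or occupied by exactly one child, and each non-root vertex occupies exactly one position of its parent. $L_{n,j}$ is the number of pairs (vertex $v$, position $j$ of $v$) such that position $j$ of $v$ is empty. *)

theory Defs
  imports "HOL-Probability.Probability_Mass_Function" "HOL-Combinatorics.Permutations"
    "HOL-Library.FuncSet"
begin

text \<open>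
  A positional tree is encoded as a partial map: \<open>t (u, j) = Some v\<close> means that position \<open>j\<close>
  of the vertex \<open>u\<close> is occupied by the child \<open>v\<close>; \<open>t (u, j) = None\<close> means that it is empty.
\<close>

type_synonym pos_tree = "nat \<times> nat \<rightharpoonup> nat"

definition tree_edges :: "pos_tree \<Rightarrow> (nat \<times> nat) set" where
  "tree_edges t = {(u, v). \<exists>j. t (u, j) = Some v}"

text \<open>
  The underlying graph is a tree rooted at 1: the root has no parent, every other vertex
  occupies exactly one position (hence has exactly one parent), and every vertex is reachable
  from the root. Labels increase along each edge, hence along each path away from the root.
\<close>

definition increasing_tree :: "nat \<Rightarrow> nat \<Rightarrow> pos_tree \<Rightarrow> bool" where
  "increasing_tree d n t \<longleftrightarrow>
     dom t \<subseteq> {1..n} \<times> {1..d} \<and>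
     ran t \<subseteq> {1..n} \<and>
     1 \<notin> ran t \<and>
     (\<forall>v\<in>{1..n} - {1}. \<exists>!p. t p = Some v) \<and>
     (\<forall>v\<in>{1..n}. (1, v) \<in> (tree_edges t)\<^sup>*) \<and>
     (\<forall>(u, v)\<in>tree_edges t. u < v)"

definition increasing_trees :: "nat \<Rightarrow> nat \<Rightarrow> pos_tree set" where
  "increasing_trees d n = {t. increasing_tree d n t}"

definition num_empty :: "nat \<Rightarrow> pos_tree \<Rightarrow> nat \<Rightarrow> nat" where
  "num_empty n t j = card {v\<in>{1..n}. t (v, j) = None}"

text \<open>Vectors indexed by \<open>{1..d}\<close> are functions that are \<open>undefined\<close> outside \<open>{1..d}\<close>.\<close>

definition empty_vector :: "nat \<Rightarrow> nat \<Rightarrow> pos_tree \<Rightarrow> nat \<Rightarrow> nat" where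
  "empty_vector d n t = (\<lambda>j\<in>{1..d}. num_empty n t j)"

definition random_increasing_tree :: "nat \<Rightarrow> nat \<Rightarrow> pos_tree pmf" where
  "random_increasing_tree d n = pmf_of_set (increasing_trees d n)"

definition exchangeable_on :: "'i set \<Rightarrow> ('i \<Rightarrow> 'a) pmf \<Rightarrow> bool" where
  "exchangeable_on I D \<longleftrightarrow> (\<forall>\<pi>. \<pi> permutes I \<longrightarrow> map_pmf (\<lambda>x. x \<circ> \<pi>) D = D)"

text \<open>
  \<^const>\<open>pmf_of_set\<close> is the uniform distribution only on a finite nonempty set.
\<close>

lemma finite_increasing_trees: "finite (increasing_trees d n)"
proof (rule finite_subset)
  show "increasing_trees d n \<subseteq>
      (\<Union>A\<in>Pow ({1..n} \<times> {1..d}). {t. dom t = A \<and> ran t \<subseteq> {1..n}})"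
    by (auto simp: increasing_trees_def increasing_tree_def)
  show "finite (\<Union>A\<in>Pow ({1..n} \<times> {1..d}). {t :: pos_tree. dom t = A \<and> ran t \<subseteq> {1..n}})"
    by (intro finite_UN_I finite_set_of_finite_maps) (auto intro: finite_subset)
qed

lemma increasing_trees_nonempty:
  assumes "d \<ge> 1" "n \<ge> 1"
  shows "increasing_trees d n \<noteq> {}"
proof -
  define t :: pos_tree where
    "t = (\<lambda>(u, j). if 1 \<le> u \<and> u < n \<and> j = 1 then Some (Suc u) else None)"
  have t_iff: "t (u, j) = Some v \<longleftrightarrow> 1 \<le> u \<and> u < n \<and> j = 1 \<and> v = Suc u" for u j v
    by (auto simp: t_def)
  have reach: "(1, v) \<in> (tree_edges t)\<^sup>*" if "1 \<le> v" "v \<le> n" for v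
    using that
  proof (induction v rule: dec_induct)
    case (step m)
    then have "(m, Suc m) \<in> tree_edges t"
      by (auto simp: tree_edges_def t_iff)
    with step show ?case by (auto intro: rtrancl_into_rtrancl)
  qed simp
  have uniq: "\<exists>!p. t p = Some v" if "v \<in> {1..n} - {1}" for v
  proof (rule ex1I[of _ "(v - 1, 1)"])
    show "t (v - 1, 1) = Some v" using that by (auto simp: t_iff)
    show "p = (v - 1, 1)" if "t p = Some v" for p
      using that by (cases p) (auto simp: t_iff)
  qed
  have "increasing_tree d n t"
    unfolding increasing_tree_def using reach uniq assms
    by (auto simp: dom_def ran_def t_iff tree_edges_def)
  then show ?thesis by (auto simp: increasing_trees_def)
qed

end

theory Submission imports Defs begin

text \<open>
  Permuting the positions at every vertex simultaneously is a bijection on the increasing trees,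
  so it preserves the uniform distribution, and it permutes the coordinates of the vector of
  empty-position counts accordingly.
\<close>

text \<open>Reading position \<open>\<pi> j\<close> of the old tree, rather than moving the child at
  \<open>j\<close> to \<open>\<pi> j\<close>, turns the count vector \<open>x\<close> into
  \<open>x \<circ> \<pi>\<close> with no inverse appearing.\<close>

definition permute_positions :: "(nat \<Rightarrow> nat) \<Rightarrow> pos_tree \<Rightarrow> pos_tree" where
  "permute_positions \<pi> t = (\<lambda>(u, j). t (u, \<pi> j))"

lemma permute_positions_apply [simp]: "permute_positions \<pi> t (u, j) = t (u, \<pi> j)"
  by (simp add: permute_positions_def)

lemma permute_positions_inverse:
  assumes "\<And>j. \<pi> (\<sigma> j) = j"
  shows "permute_positions \<sigma> (permute_positions \<pi> t) = t"
  by (auto simp: permute_positions_def assms)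

text \<open>An edge forgets which position its child occupies; surjectivity ensures that no occupied
  position is lost.\<close>

lemma tree_edges_permute_positions:
  assumes "surj \<pi>"
  shows "tree_edges (permute_positions \<pi> t) = tree_edges t"
  unfolding tree_edges_def permute_positions_apply using assms by (metis surj_def)

lemma ran_permute_positions:
  assumes "surj \<pi>"
  shows "ran (permute_positions \<pi> t) = ran t"
proof -
  have "ran t = Range (tree_edges t)" for t :: pos_tree
    by (auto simp: ran_def tree_edges_def)
  then show ?thesis by (simp add: tree_edges_permute_positions assms)
qed

text \<open>Surjectivity of \<open>\<pi>\<close> yields a position for \<open>v\<close>, injectivity
  its uniqueness.\<close>

lemma ex1_permute_positions:
  assumes "bij \<pi>" "\<exists>!p. t p = Some v"
  shows "\<exists>!p. permute_positions \<pi> t p = Some v"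
proof -
  from assms(2) obtain u j where uj: "t (u, j) = Some v"
    and uniq: "\<And>u' j'. t (u', j') = Some v \<Longrightarrow> u' = u \<and> j' = j" by (metis old.prod.exhaust prod.inject)
  from assms(1) obtain i where i: "\<pi> i = j" by (metis bij_pointE)
  show ?thesis
  proof (rule ex1I[of _ "(u, i)"])
    show "permute_positions \<pi> t (u, i) = Some v" by (simp add: i uj)
    show "p = (u, i)" if "permute_positions \<pi> t p = Some v" for p
      using that uniq i bij_is_inj[OF assms(1)] by (cases p) (auto dest: injD)
  qed
qed

text \<open>Root, reachability and label growth depend only on the edge set; just the domain bound
  and the unique position of each child involve \<open>\<pi>\<close>.\<close>

lemma increasing_tree_permute_positions:
  assumes "\<pi> permutes {1..d}" "increasing_tree d n t"
  shows "increasing_tree d n (permute_positions \<pi> t)"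
proof -
  have "bij \<pi>" using assms(1) by (rule permutes_bij)
  moreover have "dom (permute_positions \<pi> t) \<subseteq> {1..n} \<times> {1..d}"
  proof
    fix p assume p: "p \<in> dom (permute_positions \<pi> t)"
    obtain u j where "p = (u, j)" by fastforce
    with p have "(u, \<pi> j) \<in> dom t" by auto
    then have "u \<in> {1..n}" "\<pi> j \<in> {1..d}"
      using assms(2) unfolding increasing_tree_def by blast+
    then show "p \<in> {1..n} \<times> {1..d}"
      using permutes_in_image[OF assms(1), of j] \<open>p = (u, j)\<close> by blast
  qed
  ultimately show ?thesis
    using assms(2) ex1_permute_positions[of \<pi> t]
    unfolding increasing_tree_def
    by (simp add: tree_edges_permute_positions ran_permute_positions bij_is_surj)
qed

lemma bij_betw_permute_positions:
  assumes "\<pi> permutes {1..d}"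
  shows "bij_betw (permute_positions \<pi>) (increasing_trees d n) (increasing_trees d n)"
  \<comment> \<open>\<open>inv \<pi>\<close> again permutes \<open>{1..d}\<close>, so the inverse
    map also sends increasing trees to increasing trees.\<close>
  by (rule bij_betw_byWitness[of _ "permute_positions (inv \<pi>)"])
    (auto simp: increasing_trees_def permute_positions_inverse permutes_inverses[OF assms]
      intro: increasing_tree_permute_positions assms permutes_inv)

lemma empty_vector_permute_positions:
  assumes "\<pi> permutes {1..d}"
  shows "empty_vector d n (permute_positions \<pi> t) = empty_vector d n t \<circ> \<pi>"
proof
  fix j
  show "empty_vector d n (permute_positions \<pi> t) j = (empty_vector d n t \<circ> \<pi>) j"
    \<comment> \<open>\<open>j\<close> and \<open>\<pi> j\<close> lie in \<open>{1..d}\<close>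
      together or not at all; in the latter case both sides are \<open>undefined\<close>.\<close>
    using permutes_in_image[OF assms, of j]
    by (simp add: empty_vector_def num_empty_def restrict_def del: atLeastAtMost_iff)
qed

lemma random_increasing_tree_permute_positions:
  assumes "\<pi> permutes {1..d}" "d \<ge> 1" "n \<ge> 1"
  shows "map_pmf (permute_positions \<pi>) (random_increasing_tree d n) = random_increasing_tree d n"
  unfolding random_increasing_tree_def
  by (intro map_pmf_of_set_bij_betw bij_betw_permute_positions increasing_trees_nonempty
      finite_increasing_trees assms)

theorem theorem5p1:
  fixes k n :: nat
  assumes "k \<ge> 1" and "n \<ge> 1"
  shows "exchangeable_on {1..k + 1}
           (map_pmf (empty_vector (k + 1) n) (random_increasing_tree (k + 1) n))"
  unfolding exchangeable_on_def
proof (intro allI impI)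
  fix \<pi> assume \<pi>: "\<pi> permutes {1..k + 1}"
  let ?E = "empty_vector (k + 1) n" and ?T = "random_increasing_tree (k + 1) n"
  have "map_pmf (\<lambda>x. x \<circ> \<pi>) (map_pmf ?E ?T) = map_pmf ?E (map_pmf (permute_positions \<pi>) ?T)"
    \<comment> \<open>Only compositions with \<open>?E\<close> itself as a factor are unfolded, so
      \<open>\<circ> \<pi>\<close> stays intact and both sides push \<open>?T\<close> forward along
      \<open>\<lambda>t. ?E t \<circ> \<pi>\<close>.\<close>
    by (simp only: pmf.map_comp comp_def[of ?E] comp_def[of _ ?E]
        empty_vector_permute_positions[OF \<pi>])
  also have "\<dots> = map_pmf ?E ?T"
    using random_increasing_tree_permute_positions[OF \<pi>, of n] assms by simp
  finally show "map_pmf (\<lambda>x. x \<circ> \<pi>) (map_pmf ?E ?T) = map_pmf ?E ?T" .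
qed

end
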